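(* Let $G$ be a connected irregular graph on $n$ vertices with maximum degree $\Delta$ and diameter $D$. For $0 \leq \alpha < 1$, $$\rho_\alpha(G) < \Delta - \frac{2(1-\alpha)}{(2D-\alpha)n}.$$
   Context: All graphs are finite, simple and undirected. For a graph $G$, $A(G)$ is its adjacency matrix and $D(G)$ the diagonal matrix of vertex degrees. For $\alpha\in[0,1]$, $A_\alpha(G) = \alpha D(G) + (1-\alpha)A(G)$, and $\rho_\alpha(G)$ is the largest eigenvalue of $A_\alpha(G)$. A graph is irregular if not all its vertices have the same degree. The diameter is the maximum distance between two vertices. *)

theory Defs
  imports
    "Graph_Theory.Digraph_Component"
    "Jordan_Normal_Form.Spectral_Radius"
begin

text \<open>
  A finite simple undirected graph is a symmetric, loop-free digraph without parallel arcs
  (locale \<^locale>\<open>graph\<close>): an edge between \<open>u\<close> and \<open>v\<close> is a pair of opposite arcs. Hence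
  \<^const>\<open>out_degree\<close> counts the edges at a vertex, and the number of arcs of a path is its
  length in the undirected graph.
\<close>

definition irregular :: "('a, 'b) pre_digraph \<Rightarrow> bool" where
  "irregular G \<longleftrightarrow> \<not> (\<forall>u \<in> verts G. \<forall>v \<in> verts G. out_degree G u = out_degree G v)"

definition max_degree :: "('a, 'b) pre_digraph \<Rightarrow> nat" where
  "max_degree G = Max (out_degree G ` verts G)"

definition vert_dist :: "('a, 'b) pre_digraph \<Rightarrow> 'a \<Rightarrow> 'a \<Rightarrow> nat" where
  "vert_dist G u v = (LEAST k. \<exists>p. pre_digraph.apath G u p v \<and> length p = k)"

text \<open>Only meaningful for connected graphs.\<close>

definition graph_diameter :: "('a, 'b) pre_digraph \<Rightarrow> nat" where
  "graph_diameter G = Max {vert_dist G u v | u v. u \<in> verts G \<and> v \<in> verts G}"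

text \<open>
  Rows and columns of the matrices below are indexed by positions in a list \<open>vs\<close>, meant to
  enumerate \<open>verts G\<close> without repetition. Another enumeration gives a
  permutation-similar matrix.
\<close>

definition adj_mat :: "('a, 'b) pre_digraph \<Rightarrow> 'a list \<Rightarrow> real mat" where
  "adj_mat G vs =
     Matrix.mat (length vs) (length vs) (\<lambda>(i, j). if vs ! i \<rightarrow>\<^bsub>G\<^esub> vs ! j then 1 else 0)"

definition deg_mat :: "('a, 'b) pre_digraph \<Rightarrow> 'a list \<Rightarrow> real mat" where
  "deg_mat G vs = mat_diag (length vs) (\<lambda>i. real (out_degree G (vs ! i)))"

definition A_alpha :: "real \<Rightarrow> ('a, 'b) pre_digraph \<Rightarrow> 'a list \<Rightarrow> real mat" where
  "A_alpha \<alpha> G vs = \<alpha> \<cdot>\<^sub>m deg_mat G vs + (1 - \<alpha>) \<cdot>\<^sub>m adj_mat G vs"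

text \<open>
  \<^const>\<open>spectrum\<close> is taken over the reals. For a graph with at least one vertex the matrix is
  real symmetric, so its real spectrum is finite and nonempty.
\<close>

definition rho_alpha :: "real \<Rightarrow> ('a, 'b) pre_digraph \<Rightarrow> 'a list \<Rightarrow> real" where
  "rho_alpha \<alpha> G vs = Max (spectrum (A_alpha \<alpha> G vs))"

end

theory Submission
  imports Defs "HOL-Analysis.Function_Topology" "HOL-Analysis.Convex"
begin

text \<open>
  Let \<open>x\<close> be a nonnegative eigenvector for the largest eigenvalue \<open>\<mu>\<close>, scaled to maximum 1, attained
  at \<open>u\<close>. The gap \<open>\<epsilon> = \<Delta> - \<mu>\<close> satisfies
  \<open>\<epsilon> \<Sum>x\<^sub>i\<^sup>2 = \<Sum>(\<Delta> - d\<^sub>i) x\<^sub>i\<^sup>2 + (1 - \<alpha>) \<Sum>\<^sub>i\<^sub>j (x\<^sub>i - x\<^sub>j)\<^sup>2\<close>, the last sum being over the edges.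
  Cauchy--Schwarz along a path from \<open>u\<close> to a vertex \<open>v\<close> of degree less than \<open>\<Delta>\<close> bounds the right-hand
  side below, and this suffices when the path has length at most \<open>D - 1\<close>. For a path of length \<open>D\<close> the
  same estimate is applied from its second vertex \<open>w\<close>: the eigenvalue equation at \<open>u\<close> forces
  \<open>x\<^sub>w \<ge> 1 - \<epsilon> / (1 - \<alpha>)\<close>, and the small loss is recovered because \<open>x\<close> is well below 1 at \<open>v\<close> and at
  some neighbour of \<open>v\<close>.
\<close>

section \<open>Rayleigh quotients of nonnegative symmetric matrices\<close>

text \<open>Tychonoff's theorem. Vectors are total functions, so coordinates outside
  \<open>V\<close> are pinned to 0 instead of ranging over the whole line.\<close>

lemma compact_cube:
  fixes V :: "'v set"
  shows "compact {x :: 'v \<Rightarrow> real. (\<forall>i\<in>V. 0 \<le> x i \<and> x i \<le> 1) \<and> (\<forall>i. i \<notin> V \<longrightarrow> x i = 0)}"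
proof -
  have "compactin (product_topology (\<lambda>_. euclidean) UNIV)
      (PiE UNIV (\<lambda>i. if i \<in> V then {0..1::real} else {0}))"
    by (subst compactin_PiE) auto
  then have "compact (PiE UNIV (\<lambda>i. if i \<in> V then {0..1::real} else {0}))"
    by (simp add: euclidean_product_topology)
  also have "PiE UNIV (\<lambda>i. if i \<in> V then {0..1::real} else {0}) =
      {x. (\<forall>i\<in>V. 0 \<le> x i \<and> x i \<le> 1) \<and> (\<forall>i. i \<notin> V \<longrightarrow> x i = 0)}"
    by (auto simp: PiE_UNIV_domain Pi_iff split: if_splits)
  finally show ?thesis .
qed

text \<open>As \<open>a\<close> is nonnegative, replacing entries by absolute values does not
  decrease the quadratic form. A maximiser over the nonnegative part of the unit sphere, a compact
  set, thus also dominates vectors of arbitrary sign.\<close>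

lemma rayleigh_maximiser_nonneg:
  fixes a :: "'v \<Rightarrow> 'v \<Rightarrow> real"
  assumes fin: "finite V" and ne: "V \<noteq> {}"
    and nonneg: "\<And>i j. i \<in> V \<Longrightarrow> j \<in> V \<Longrightarrow> 0 \<le> a i j"
  obtains x \<mu> where "\<forall>i\<in>V. 0 \<le> x i" "(\<Sum>i\<in>V. (x i)\<^sup>2) = 1"
    "(\<Sum>i\<in>V. \<Sum>j\<in>V. a i j * x i * x j) = \<mu>"
    "\<forall>y. (\<Sum>i\<in>V. \<Sum>j\<in>V. a i j * y i * y j) \<le> \<mu> * (\<Sum>i\<in>V. (y i)\<^sup>2)"
proof -
  define q where "q y = (\<Sum>i\<in>V. \<Sum>j\<in>V. a i j * y i * y j)" for y :: "'v \<Rightarrow> real"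
  define N where "N y = (\<Sum>i\<in>V. (y i)\<^sup>2)" for y :: "'v \<Rightarrow> real"
  define C where "C = {x :: 'v \<Rightarrow> real. (\<forall>i\<in>V. 0 \<le> x i \<and> x i \<le> 1) \<and> (\<forall>i. i \<notin> V \<longrightarrow> x i = 0)}"
  have contq: "continuous_on UNIV q" and contN: "continuous_on UNIV N"
    unfolding q_def N_def by (intro continuous_intros continuous_on_product_coordinates)+
  have "closed {x. N x = 1}"
    by (intro closed_Collect_eq contN continuous_intros)
  then have comp: "compact (C \<inter> {x. N x = 1})"
    unfolding C_def by (intro compact_Int_closed compact_cube)
  obtain k where k: "k \<in> V" using ne by blast
  have "(\<lambda>i. if i = k then 1 else 0) \<in> C \<inter> {x. N x = 1}"
    using k fin by (auto simp: C_def N_def if_distrib[of "\<lambda>z. z\<^sup>2"] sum.delta cong: if_cong)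
  then obtain x where x: "x \<in> C" "N x = 1" and max: "\<And>y. y \<in> C \<Longrightarrow> N y = 1 \<Longrightarrow> q y \<le> q x"
    using continuous_attains_sup[OF comp _ continuous_on_subset[OF contq]] by blast
  have "q y \<le> q x * N y" for y
  proof (cases "N y = 0")
    case True
    then have "\<And>i. i \<in> V \<Longrightarrow> y i = 0"
      using fin by (auto simp: N_def sum_nonneg_eq_0_iff)
    then show ?thesis using True by (simp add: q_def)
  next
    case False
    define r where "r = sqrt (N y)"
    have "N y \<ge> 0" by (simp add: N_def sum_nonneg)
    with False have r: "r > 0" "r\<^sup>2 = N y" by (auto simp: r_def)
    define z where "z i = (if i \<in> V then \<bar>y i\<bar> / r else 0)" for i
    have "N z = (\<Sum>i\<in>V. (y i)\<^sup>2 / r\<^sup>2)"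
      unfolding N_def z_def by (intro sum.cong) (auto simp: power_divide)
    also have "\<dots> = N y / r\<^sup>2" by (simp add: N_def sum_divide_distrib)
    finally have Nz: "N z = 1" using r False by simp
    have "z i \<le> 1" if "i \<in> V" for i
    proof -
      have "(z i)\<^sup>2 \<le> N z" unfolding N_def using fin that by (intro member_le_sum) auto
      then show ?thesis using Nz by (simp add: power2_le_imp_le)
    qed
    then have "z \<in> C" using r by (auto simp: C_def z_def)
    then have qz: "q z \<le> q x" using Nz max by blast
    have "q y \<le> (\<Sum>i\<in>V. \<Sum>j\<in>V. a i j * \<bar>y i\<bar> * \<bar>y j\<bar>)"
      unfolding q_def
    proof (intro sum_mono)
      fix i j assume "i \<in> V" "j \<in> V"
      then have "a i j * (y i * y j) \<le> a i j * \<bar>y i * y j\<bar>"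
        using nonneg by (intro mult_left_mono) auto
      then show "a i j * y i * y j \<le> a i j * \<bar>y i\<bar> * \<bar>y j\<bar>" by (simp add: abs_mult mult.assoc)
    qed
    also have "\<dots> = (\<Sum>i\<in>V. \<Sum>j\<in>V. r\<^sup>2 * (a i j * z i * z j))"
      using r by (intro sum.cong) (auto simp: z_def power2_eq_square)
    also have "\<dots> = r\<^sup>2 * q z" by (simp add: q_def sum_distrib_left)
    also have "\<dots> \<le> r\<^sup>2 * q x" using qz by (intro mult_left_mono) auto
    finally show ?thesis using r by (simp add: mult.commute)
  qed
  then show ?thesis using x that[of x "q x"] by (auto simp: q_def N_def C_def)
qed

text \<open>
  A maximiser of the Rayleigh quotient is an eigenvector: \<open>\<mu> I - a\<close> is positive semidefinite
  and its quadratic form vanishes at \<open>x\<close>, so its first variation there vanishes too.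
\<close>

lemma rayleigh_maximiser_eigenvector:
  fixes a :: "'v \<Rightarrow> 'v \<Rightarrow> real"
  assumes fin: "finite V"
    and sym: "\<And>i j. i \<in> V \<Longrightarrow> j \<in> V \<Longrightarrow> a i j = a j i"
    and x: "(\<Sum>i\<in>V. \<Sum>j\<in>V. a i j * x i * x j) = \<mu> * (\<Sum>i\<in>V. (x i)\<^sup>2)"
    and max: "\<And>y. (\<Sum>i\<in>V. \<Sum>j\<in>V. a i j * y i * y j) \<le> \<mu> * (\<Sum>i\<in>V. (y i)\<^sup>2)"
    and k: "k \<in> V"
  shows "(\<Sum>j\<in>V. a k j * x j) = \<mu> * x k"
proof -
  define g where "g = \<mu> * x k - (\<Sum>j\<in>V. a k j * x j)"
  define e where "e i = (if i = k then 1 else 0 :: real)" for i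
  have *: "0 \<le> 2 * c * g + c\<^sup>2 * (\<mu> - a k k)" for c
  proof -
    have e1: "(\<Sum>i\<in>V. f i * e i) = f k" for f :: "'v \<Rightarrow> real"
      using fin k by (simp add: e_def if_distrib[of "\<lambda>z. _ * z"] sum.delta cong: if_cong)
    have "(\<Sum>i\<in>V. (x i + c * e i)\<^sup>2) = (\<Sum>i\<in>V. (x i)\<^sup>2 + 2 * c * (x i * e i) + c\<^sup>2 * (e i * e i))"
      by (simp add: power2_eq_square algebra_simps)
    also have "\<dots> = (\<Sum>i\<in>V. (x i)\<^sup>2) + 2 * c * x k + c\<^sup>2"
      unfolding sum.distrib sum_distrib_left[symmetric] e1 by (simp add: e_def)
    finally have n: "(\<Sum>i\<in>V. (x i + c * e i)\<^sup>2) = (\<Sum>i\<in>V. (x i)\<^sup>2) + 2 * c * x k + c\<^sup>2" .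
    have "(\<Sum>i\<in>V. \<Sum>j\<in>V. a i j * (x i + c * e i) * (x j + c * e j)) =
        (\<Sum>i\<in>V. \<Sum>j\<in>V. a i j * x i * x j + c * ((a i j * x i) * e j) + c * ((a i j * x j) * e i)
          + c\<^sup>2 * (a i j * e i * e j))"
      by (intro sum.cong) (auto simp: power2_eq_square algebra_simps)
    also have "\<dots> = (\<Sum>i\<in>V. \<Sum>j\<in>V. a i j * x i * x j) + c * (\<Sum>i\<in>V. a i k * x i)
        + c * (\<Sum>i\<in>V. (\<Sum>j\<in>V. a i j * x j) * e i) + c\<^sup>2 * (\<Sum>i\<in>V. a i k * e i)"
      unfolding sum.distrib sum_distrib_left[symmetric] e1 sum_distrib_right[symmetric] by simp
    also have "(\<Sum>i\<in>V. a i k * x i) = (\<Sum>j\<in>V. a k j * x j)"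
      using sym k by (intro sum.cong) auto
    finally have "(\<Sum>i\<in>V. \<Sum>j\<in>V. a i j * (x i + c * e i) * (x j + c * e j)) =
      \<mu> * (\<Sum>i\<in>V. (x i)\<^sup>2) + 2 * c * (\<Sum>j\<in>V. a k j * x j) + c\<^sup>2 * a k k"
      unfolding e1 x by simp
    then show ?thesis
      using max[of "\<lambda>i. x i + c * e i"] unfolding n g_def by (simp add: algebra_simps)
  qed
  have "g = 0"
  proof (rule ccontr)
    assume g: "g \<noteq> 0"
    \<comment> \<open>With \<open>h\<close> positive and above the quadratic coefficient, the choice
      \<open>c = - g / h\<close> turns \<open>*\<close> into
      \<open>0 \<le> - (g\<^sup>2 / h)\<close>.\<close>
    define h where "h = \<bar>\<mu> - a k k\<bar> + 1"
    have h: "h > 0" "\<mu> - a k k < h" by (auto simp: h_def)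
    have "(- g / h)\<^sup>2 * (\<mu> - a k k) \<le> (- g / h)\<^sup>2 * h"
      using h by (intro mult_left_mono) auto
    also have "\<dots> = g\<^sup>2 / h" using h by (simp add: power2_eq_square)
    finally have "0 \<le> 2 * (- g / h) * g + g\<^sup>2 / h" using *[of "- g / h"] by linarith
    also have "\<dots> = - (g\<^sup>2 / h)" by (simp add: power2_eq_square)
    finally show False using g h by (simp add: divide_le_0_iff)
  qed
  then show ?thesis by (simp add: g_def)
qed

text \<open>The Rayleigh maximum bounds every real eigenvalue from above, and dividing its maximiser
  by the largest entry makes that entry 1. An inequality for \<open>Max (spectrum A)\<close> is
  enough for an upper bound on it.\<close>

lemma nonneg_eigenpair_of_max_eigenvalue:
  fixes a :: "'v \<Rightarrow> 'v \<Rightarrow> real" and vs :: "'v list"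
  assumes vs: "distinct vs" "set vs = V" "V \<noteq> {}"
    and sym: "\<And>i j. i \<in> V \<Longrightarrow> j \<in> V \<Longrightarrow> a i j = a j i"
    and nonneg: "\<And>i j. i \<in> V \<Longrightarrow> j \<in> V \<Longrightarrow> 0 \<le> a i j"
    and A: "A = Matrix.mat (length vs) (length vs) (\<lambda>(i, j). a (vs ! i) (vs ! j))"
  obtains x \<mu> where "Max (spectrum A) \<le> \<mu>" "\<forall>i\<in>V. 0 \<le> x i \<and> x i \<le> 1"
    "\<exists>i\<in>V. x i = 1" "\<forall>i\<in>V. (\<Sum>j\<in>V. a i j * x j) = \<mu> * x i"
proof -
  let ?m = "length vs"
  have fin: "finite V" using vs by auto
  have bij: "bij_betw ((!) vs) {0..<?m} V"
    using vs by (auto simp: lessThan_atLeast0[symmetric] intro: bij_betw_nth)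
  have sum_idx: "(\<Sum>i\<in>{0..<?m}. f (vs ! i)) = (\<Sum>i\<in>V. f i)" for f :: "'v \<Rightarrow> real"
    using bij by (rule sum.reindex_bij_betw)
  have mv: "(A *\<^sub>v z) $ i = (\<Sum>j\<in>{0..<?m}. a (vs ! i) (vs ! j) * z $ j)"
    if "i < ?m" "z \<in> carrier_vec ?m" for z i
    using that by (simp add: A scalar_prod_def)
  obtain z \<mu> where z: "\<forall>i\<in>V. 0 \<le> z i" "(\<Sum>i\<in>V. (z i)\<^sup>2) = 1"
    "(\<Sum>i\<in>V. \<Sum>j\<in>V. a i j * z i * z j) = \<mu>"
    and max: "\<forall>y. (\<Sum>i\<in>V. \<Sum>j\<in>V. a i j * y i * y j) \<le> \<mu> * (\<Sum>i\<in>V. (y i)\<^sup>2)"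
    using rayleigh_maximiser_nonneg[where a = a, OF fin vs(3) nonneg] by blast
  have eig: "(\<Sum>j\<in>V. a i j * z j) = \<mu> * z i" if "i \<in> V" for i
    using rayleigh_maximiser_eigenvector[of V a z \<mu> i] fin sym z max that by simp
  have "Max (z ` V) \<in> z ` V" using fin vs(3) by (intro Max_in) auto
  then obtain k where k: "k \<in> V" "Max (z ` V) = z k" by auto
  have k_max: "z i \<le> z k" if "i \<in> V" for i
    using that fin by (simp flip: k(2))
  have "z k \<noteq> 0"
  proof
    assume "z k = 0"
    then have "\<And>i. i \<in> V \<Longrightarrow> z i = 0" using k_max z(1) by (simp add: order_antisym)
    then show False using z(2) by simp
  qed
  then have zk: "z k > 0" using z(1) k(1) by (simp add: order_less_le)
  have "Max (spectrum A) \<le> \<mu>"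
  proof (rule Max.boundedI)
    have carr: "A \<in> carrier_mat ?m ?m" by (simp add: A)
    show "finite (spectrum A)" using card_finite_spectrum[OF carr] by simp
    \<comment> \<open>The maximiser, read as a vector over positions, shows that the spectrum is
      nonempty; otherwise \<open>Max\<close> would be unspecified.\<close>
    have "eigenvector A (vec ?m (\<lambda>i. z (vs ! i))) \<mu>"
      unfolding eigenvector_def
    proof (intro conjI)
      obtain i where i: "i < ?m" "vs ! i = k" using k vs by (metis in_set_conv_nth)
      show "vec ?m (\<lambda>i. z (vs ! i)) \<noteq> 0\<^sub>v (dim_row A)"
      proof
        assume "vec ?m (\<lambda>i. z (vs ! i)) = 0\<^sub>v (dim_row A)"
        then have "vec ?m (\<lambda>i. z (vs ! i)) $ i = 0\<^sub>v (dim_row A) $ i" by simp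
        then show False using i zk by (simp add: A)
      qed
      show "A *\<^sub>v vec ?m (\<lambda>i. z (vs ! i)) = \<mu> \<cdot>\<^sub>v vec ?m (\<lambda>i. z (vs ! i))"
      proof (rule eq_vecI)
        fix i assume i: "i < dim_vec (\<mu> \<cdot>\<^sub>v vec ?m (\<lambda>i. z (vs ! i)))"
        then have "(A *\<^sub>v vec ?m (\<lambda>i. z (vs ! i))) $ i = (\<Sum>j\<in>{0..<?m}. a (vs ! i) (vs ! j) * z (vs ! j))"
          by (subst mv) auto
        also have "\<dots> = \<mu> * z (vs ! i)"
          using i vs sum_idx[of "\<lambda>j. a (vs ! i) j * z j"] eig[of "vs ! i"] by auto
        finally show "(A *\<^sub>v vec ?m (\<lambda>i. z (vs ! i))) $ i = (\<mu> \<cdot>\<^sub>v vec ?m (\<lambda>i. z (vs ! i))) $ i"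
          using i by simp
      qed (simp add: A)
    qed (simp add: A)
    then show "spectrum A \<noteq> {}" by (auto simp: spectrum_def eigenvalue_def)
    fix l assume "l \<in> spectrum A"
    then obtain y where y: "y \<in> carrier_vec ?m" "y \<noteq> 0\<^sub>v ?m" "A *\<^sub>v y = l \<cdot>\<^sub>v y"
      by (auto simp: spectrum_def eigenvalue_def eigenvector_def A)
    \<comment> \<open>An arbitrary eigenvector \<open>y\<close> is carried back from positions to
      vertices, where \<open>max\<close> applies.\<close>
    define f where "f = (\<lambda>i. y $ inv_into {0..<?m} ((!) vs) i)"
    have f: "f (vs ! i) = y $ i" if "i < ?m" for i
      using bij_betw_inv_into_left[OF bij, of i] that by (simp add: f_def)
    have row: "(\<Sum>j\<in>V. a i j * f j) = l * f i" if i: "i \<in> V" for i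
    proof -
      obtain i' where i': "i' < ?m" "i = vs ! i'" using i vs by (metis in_set_conv_nth)
      have "(\<Sum>j\<in>V. a i j * f j) = (\<Sum>j\<in>{0..<?m}. a i (vs ! j) * f (vs ! j))"
        by (rule sum_idx[of "\<lambda>j. a i j * f j", symmetric])
      also have "\<dots> = (A *\<^sub>v y) $ i'" using i' y(1) by (simp add: mv f)
      also have "\<dots> = l * f i" using y i' by (simp add: f)
      finally show ?thesis .
    qed
    have "(\<Sum>i\<in>V. \<Sum>j\<in>V. a i j * f i * f j) = (\<Sum>i\<in>V. f i * (\<Sum>j\<in>V. a i j * f j))"
      by (simp add: sum_distrib_left mult_ac)
    also have "\<dots> = (\<Sum>i\<in>V. f i * (l * f i))"
      by (intro sum.cong) (auto simp: row)
    also have "\<dots> = l * (\<Sum>i\<in>V. (f i)\<^sup>2)"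
      by (simp add: sum_distrib_left power2_eq_square mult_ac)
    finally have le: "l * (\<Sum>i\<in>V. (f i)\<^sup>2) \<le> \<mu> * (\<Sum>i\<in>V. (f i)\<^sup>2)" using max[rule_format, of f] by simp
    have "(\<Sum>i\<in>V. (f i)\<^sup>2) \<noteq> 0"
    proof
      assume "(\<Sum>i\<in>V. (f i)\<^sup>2) = 0"
      then have f0: "\<And>i. i \<in> V \<Longrightarrow> f i = 0" using fin by (simp add: sum_nonneg_eq_0_iff)
      have "y $ i = 0" if "i < ?m" for i using f[OF that] f0[of "vs ! i"] that vs by auto
      then have "y = 0\<^sub>v ?m" using y(1) by (intro eq_vecI) auto
      then show False using y(2) by simp
    qed
    then have "(\<Sum>i\<in>V. (f i)\<^sup>2) > 0" by (simp add: sum_nonneg less_le)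
    then show "l \<le> \<mu>" using le by simp
  qed
  moreover have "(\<Sum>j\<in>V. a i j * (z j / z k)) = \<mu> * (z i / z k)" if "i \<in> V" for i
    using eig[OF that] by (simp flip: sum_divide_distrib)
  ultimately show ?thesis
    using that[of \<mu> "\<lambda>i. z i / z k"] zk z(1) k(1) k_max by (auto simp: field_simps)
qed

section \<open>Energy along paths\<close>

locale simple_graph =
  fixes V :: "'v set" and E :: "'v \<Rightarrow> 'v \<Rightarrow> bool"
  assumes finite_V: "finite V"
    and E_in: "E i j \<Longrightarrow> i \<in> V \<and> j \<in> V"
    and E_sym: "E i j \<Longrightarrow> E j i"
    and E_irrefl: "\<not> E i i"
begin

definition nb :: "'v \<Rightarrow> 'v set" where "nb i = {j. E i j}"

definition deg :: "'v \<Rightarrow> nat" where "deg i = card (nb i)"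

lemma nb_subset: "nb i \<subseteq> V"
  using E_in by (auto simp: nb_def)

lemma finite_nb [simp]: "finite (nb i)"
  using nb_subset finite_V by (rule finite_subset)

lemma sum_nb_swap:
  fixes f :: "'v \<Rightarrow> 'v \<Rightarrow> 'c::comm_monoid_add"
  shows "(\<Sum>i\<in>V. \<Sum>j\<in>nb i. f i j) = (\<Sum>i\<in>V. \<Sum>j\<in>nb i. f j i)"
proof -
  have nb: "nb i = {j \<in> V. E i j}" "nb i = {j \<in> V. E j i}" for i
    using E_in E_sym by (auto simp: nb_def)
  have "(\<Sum>i\<in>V. \<Sum>j | j \<in> V \<and> E i j. f i j) = (\<Sum>j\<in>V. \<Sum>i | i \<in> V \<and> E i j. f i j)"
    using finite_V finite_V by (rule sum.swap_restrict)
  then show ?thesis by (simp flip: nb)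
qed

text \<open>Handshake lemma, adding vertices one at a time: an edge between the new vertex and
  \<open>W\<close> is counted once at each end. It later rules out a single vertex of odd
  degree.\<close>

lemma even_sum_deg: "even (\<Sum>i\<in>V. deg i)"
proof -
  have "even (\<Sum>i\<in>W. card {j \<in> W. E i j})" if "finite W" for W
    using that
  proof (induction W)
    case (insert v W)
    have split: "{j \<in> insert v W. E i j} = (if E i v then insert v {j \<in> W. E i j} else {j \<in> W. E i j})" for i
      by auto
    have "(\<Sum>i\<in>W. card {j \<in> insert v W. E i j}) = (\<Sum>i\<in>W. card {j \<in> W. E i j} + (if E i v then 1 else 0))"
      unfolding split using insert.hyps by (intro sum.cong) auto
    also have "\<dots> = (\<Sum>i\<in>W. card {j \<in> W. E i j}) + card {j \<in> W. E j v}"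
      using insert.hyps by (simp add: sum.distrib sum.If_cases Int_def)
    also have "{j \<in> W. E j v} = {j \<in> insert v W. E v j}"
      using E_sym E_irrefl by auto
    finally show ?case
      using insert by simp
  qed simp
  from this[OF finite_V] show ?thesis
    by (metis (no_types, lifting) Collect_cong E_in deg_def nb_def sum.cong)
qed

text \<open>Dirichlet energy, the quadratic form of the Laplacian. The double sum meets each edge in
  both orientations, hence the factor 1/2.\<close>

definition energy :: "('v \<Rightarrow> real) \<Rightarrow> real" where
  "energy x = (\<Sum>i\<in>V. \<Sum>j\<in>nb i. (x i - x j)\<^sup>2) / 2"

lemma energy_nonneg: "0 \<le> energy x"
  by (simp add: energy_def sum_nonneg)

lemma energy_eq:
  "energy x = (\<Sum>i\<in>V. real (deg i) * (x i)\<^sup>2) - (\<Sum>i\<in>V. x i * (\<Sum>j\<in>nb i. x j))"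
proof -
  have "(\<Sum>i\<in>V. \<Sum>j\<in>nb i. (x i - x j)\<^sup>2) =
      (\<Sum>i\<in>V. \<Sum>j\<in>nb i. (x i)\<^sup>2) + (\<Sum>i\<in>V. \<Sum>j\<in>nb i. (x j)\<^sup>2) - 2 * (\<Sum>i\<in>V. \<Sum>j\<in>nb i. x i * x j)"
    by (simp add: power2_diff sum.distrib sum_subtractf sum_distrib_left mult.assoc)
  also have "(\<Sum>i\<in>V. \<Sum>j\<in>nb i. (x j)\<^sup>2) = (\<Sum>i\<in>V. \<Sum>j\<in>nb i. (x i)\<^sup>2)"
    by (rule sum_nb_swap)
  finally show ?thesis
    by (simp add: energy_def deg_def field_simps flip: sum_distrib_left)
qed

text \<open>Paths are vertex lists, so the number of edges is \<open>length p - 1\<close>; a single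
  vertex is a path.\<close>

definition path :: "'v list \<Rightarrow> bool" where
  "path p \<longleftrightarrow> p \<noteq> [] \<and> distinct p \<and> successively E p"

text \<open>
  Each edge of the path occurs twice, in both orientations, in the double sum defining
  \<^const>\<open>energy\<close>.
\<close>

lemma path_sum_squares_le_energy:
  assumes "path p"
  shows "(\<Sum>i<length p - 1. (x (p ! i) - x (p ! Suc i))\<^sup>2) \<le> energy x"
proof -
  define k where "k = length p - 1"
  have E: "E (p ! i) (p ! Suc i)" if "i < k" for i
    using assms that by (auto simp: path_def k_def successively_conv_nth)
  have idx: "p ! i = p ! j \<longleftrightarrow> i = j" if "i \<le> k" "j \<le> k" for i j
    using assms that by (auto simp: path_def k_def nth_eq_iff_index_eq Suc_le_eq le_eq_less_or_eq)
  define f where "f = (\<lambda>(a, b). (x a - x b)\<^sup>2)"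
  define F where "F = (\<lambda>i. (p ! i, p ! Suc i)) ` {..<k}"
  define F' where "F' = (\<lambda>i. (p ! Suc i, p ! i)) ` {..<k}"
  have sF: "sum f F = (\<Sum>i<k. (x (p ! i) - x (p ! Suc i))\<^sup>2)"
    unfolding F_def by (subst sum.reindex) (auto simp: inj_on_def idx f_def)
  have sF': "sum f F' = (\<Sum>i<k. (x (p ! i) - x (p ! Suc i))\<^sup>2)"
    unfolding F'_def by (subst sum.reindex) (auto simp: inj_on_def idx f_def power2_commute)
  have disj: "F \<inter> F' = {}"
    by (auto simp: F_def F'_def idx)
  have "sum f (F \<union> F') \<le> sum f (Sigma V nb)"
    using E E_in E_sym
    by (intro sum_mono2 finite_SigmaI finite_V finite_nb) (auto simp: F_def F'_def f_def nb_def)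
  also have "\<dots> = 2 * energy x"
    using finite_V by (simp add: energy_def f_def sum.Sigma)
  also have "sum f (F \<union> F') = sum f F + sum f F'"
    using disj by (intro sum.union_disjoint) (auto simp: F_def F'_def)
  finally show ?thesis unfolding sF sF' k_def[symmetric] by simp
qed

text \<open>Telescoping along the path, then Cauchy-Schwarz over its edges.\<close>

lemma path_difference_le_energy:
  assumes "path p"
  shows "(x (hd p) - x (last p))\<^sup>2 \<le> real (length p - 1) * energy x"
proof -
  define k where "k = length p - 1"
  have "x (hd p) - x (last p) = (\<Sum>i<k. x (p ! i) - x (p ! Suc i))"
    using assms sum_lessThan_telescope'[of "\<lambda>i. x (p ! i)" k]
    by (simp add: path_def hd_conv_nth last_conv_nth k_def)
  also have "\<dots>\<^sup>2 \<le> real k * (\<Sum>i<k. (x (p ! i) - x (p ! Suc i))\<^sup>2)"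
    using sum_squared_le_sum_of_squares[of "\<lambda>i. x (p ! i) - x (p ! Suc i)" "{..<k}"]
    by (simp add: mult.commute)
  also have "\<dots> \<le> real k * energy x"
    using path_sum_squares_le_energy[OF assms] unfolding k_def by (intro mult_left_mono) auto
  finally show ?thesis by (simp add: k_def)
qed

end

section \<open>The eigenvalue gap\<close>

text \<open>For fixed \<open>s\<close>, the expression
  \<open>t\<^sup>2 + \<beta> * (s - t)\<^sup>2 / K\<close> is minimal where
  \<open>K * t = \<beta> * (s - t)\<close>, with value
  \<open>\<beta> * s\<^sup>2 / (K + \<beta>)\<close>; the square opening the proof vanishes exactly
  there. In the application \<open>s\<close> and \<open>t\<close> are the entries at the ends of a
  path and \<open>K\<close> bounds its number of edges.\<close>

lemma weighted_squares_ge: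
  fixes t s e K \<beta> :: real
  assumes "\<beta> > 0" "K > 0" "(s - t)\<^sup>2 \<le> K * e"
  shows "\<beta> * s\<^sup>2 \<le> (K + \<beta>) * (t\<^sup>2 + \<beta> * e)"
proof -
  have "0 \<le> (K * t - \<beta> * (s - t))\<^sup>2" by simp
  then have "K * (\<beta> * s\<^sup>2) \<le> (K + \<beta>) * (K * t\<^sup>2 + \<beta> * (s - t)\<^sup>2)"
    by (simp add: power2_eq_square algebra_simps)
  also have "\<dots> \<le> (K + \<beta>) * (K * t\<^sup>2 + \<beta> * (K * e))"
    using assms by (intro mult_left_mono add_left_mono) auto
  also have "\<dots> = K * ((K + \<beta>) * (t\<^sup>2 + \<beta> * e))" by (simp add: algebra_simps)
  finally show ?thesis using assms by simp
qed

text \<open>The numerical contradiction for paths of length \<open>D\<close>, with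
  \<open>R = D - \<alpha> / 2\<close> and \<open>D \<ge> 2\<close>. In terms of the excess
  \<open>r\<close> over the least value of \<open>R\<close>, the difference of the two sides is a
  positive constant plus nonnegative terms.\<close>

lemma quadratic_gap:
  fixes \<alpha> R :: real
  assumes "0 \<le> \<alpha>" "\<alpha> < 1" "2 - \<alpha> / 2 \<le> R"
  shows "2 * R + (1 - \<alpha>)\<^sup>2 + (3 / 2 - \<alpha> / 2)\<^sup>2 < 2 * R\<^sup>2"
proof -
  define r where "r = R - (2 - \<alpha> / 2)"
  have R: "R = r + 2 - \<alpha> / 2" "r \<ge> 0" using assms by (auto simp: r_def)
  have "2 * R\<^sup>2 - (2 * R + (1 - \<alpha>)\<^sup>2 + (3 / 2 - \<alpha> / 2)\<^sup>2) =
      3 / 4 * (1 - \<alpha>\<^sup>2) + \<alpha> / 2 + r * (6 - 2 * \<alpha>) + 2 * r\<^sup>2"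
    unfolding R(1) by (simp add: power2_eq_square field_simps)
  moreover have "0 < 3 / 4 * (1 - \<alpha>\<^sup>2) + \<alpha> / 2 + r * (6 - 2 * \<alpha>) + 2 * r\<^sup>2"
    using assms R by (intro add_pos_nonneg mult_nonneg_nonneg) (auto simp: power_less_one_iff)
  ultimately show ?thesis by simp
qed

section \<open>Identities and bounds for an eigenvector with entries in [0, 1]\<close>

locale alpha_eigenpair = simple_graph V E for V :: "'v set" and E +
  fixes x :: "'v \<Rightarrow> real" and \<alpha> \<mu> :: real and \<Delta> :: nat
  assumes alpha: "0 \<le> \<alpha>" "\<alpha> < 1"
    and x_nonneg: "i \<in> V \<Longrightarrow> 0 \<le> x i"
    and x_le_1: "i \<in> V \<Longrightarrow> x i \<le> 1"
    and eigen: "i \<in> V \<Longrightarrow> \<alpha> * real (deg i) * x i + (1 - \<alpha>) * (\<Sum>j\<in>nb i. x j) = \<mu> * x i"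
    and deg_le: "i \<in> V \<Longrightarrow> deg i \<le> \<Delta>"
begin

abbreviation gap :: real where "gap \<equiv> real \<Delta> - \<mu>"

definition dfc :: "'v \<Rightarrow> real" where "dfc i = real \<Delta> - real (deg i)"

lemma dfc_nonneg: "i \<in> V \<Longrightarrow> 0 \<le> dfc i"
  using deg_le by (simp add: dfc_def)

lemma dfc_ge_1: "i \<in> V \<Longrightarrow> deg i \<noteq> \<Delta> \<Longrightarrow> 1 \<le> dfc i"
  using deg_le[of i] by (simp add: dfc_def)

text \<open>Pairing the eigenvalue equation with \<open>x\<close>: \<Delta> times the identity minus
  the matrix is the diagonal of the deficiencies \<open>dfc\<close> plus 1 - \<alpha> times the
  Laplacian.\<close>

lemma gap_norm_eq: "gap * (\<Sum>i\<in>V. (x i)\<^sup>2) = (\<Sum>i\<in>V. dfc i * (x i)\<^sup>2) + (1 - \<alpha>) * energy x"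
proof -
  have "\<mu> * (\<Sum>i\<in>V. (x i)\<^sup>2) = (\<Sum>i\<in>V. x i * (\<mu> * x i))"
    by (simp add: sum_distrib_left power2_eq_square algebra_simps)
  also have "\<dots> = (\<Sum>i\<in>V. x i * (\<alpha> * real (deg i) * x i + (1 - \<alpha>) * (\<Sum>j\<in>nb i. x j)))"
    by (intro sum.cong) (auto simp: eigen)
  also have "\<dots> = (\<Sum>i\<in>V. \<alpha> * (real (deg i) * (x i)\<^sup>2) + (1 - \<alpha>) * (x i * (\<Sum>j\<in>nb i. x j)))"
    by (simp add: power2_eq_square algebra_simps)
  also have "\<dots> = \<alpha> * (\<Sum>i\<in>V. real (deg i) * (x i)\<^sup>2) + (1 - \<alpha>) * (\<Sum>i\<in>V. x i * (\<Sum>j\<in>nb i. x j))"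
    by (simp only: sum.distrib sum_distrib_left)
  finally have "\<mu> * (\<Sum>i\<in>V. (x i)\<^sup>2) = \<dots>" .
  moreover have "(\<Sum>i\<in>V. dfc i * (x i)\<^sup>2) = \<Delta> * (\<Sum>i\<in>V. (x i)\<^sup>2) - (\<Sum>i\<in>V. real (deg i) * (x i)\<^sup>2)"
    by (simp add: dfc_def left_diff_distrib sum_subtractf sum_distrib_left)
  ultimately show ?thesis
    unfolding energy_eq by (simp add: algebra_simps)
qed

lemma gap_nonneg:
  assumes "i \<in> V" "x i \<noteq> 0"
  shows "0 \<le> gap"
proof -
  have "0 < (x i)\<^sup>2" using assms by simp
  also have "\<dots> \<le> (\<Sum>i\<in>V. (x i)\<^sup>2)"
    using finite_V assms by (intro member_le_sum) auto
  finally have "0 < (\<Sum>i\<in>V. (x i)\<^sup>2)" .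
  moreover have "0 \<le> gap * (\<Sum>i\<in>V. (x i)\<^sup>2)"
    unfolding gap_norm_eq using alpha dfc_nonneg energy_nonneg
    by (intro add_nonneg_nonneg sum_nonneg mult_nonneg_nonneg) auto
  ultimately show ?thesis by (simp add: zero_le_mult_iff)
qed

text \<open>Pairing with the all-ones vector instead, which the Laplacian annihilates.\<close>

lemma sum_dfc_eq: "(\<Sum>i\<in>V. dfc i * x i) = gap * (\<Sum>i\<in>V. x i)"
proof -
  have "\<mu> * (\<Sum>i\<in>V. x i) = (\<Sum>i\<in>V. \<alpha> * (real (deg i) * x i) + (1 - \<alpha>) * (\<Sum>j\<in>nb i. x j))"
    by (simp add: sum_distrib_left flip: eigen) (simp add: mult.assoc flip: sum_distrib_left)
  also have "\<dots> = \<alpha> * (\<Sum>i\<in>V. real (deg i) * x i) + (1 - \<alpha>) * (\<Sum>i\<in>V. \<Sum>j\<in>nb i. x j)"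
    by (simp only: sum.distrib sum_distrib_left)
  also have "(\<Sum>i\<in>V. \<Sum>j\<in>nb i. x j) = (\<Sum>i\<in>V. \<Sum>j\<in>nb i. x i)"
    by (rule sum_nb_swap)
  also have "\<dots> = (\<Sum>i\<in>V. real (deg i) * x i)" by (simp add: deg_def)
  finally have "\<mu> * (\<Sum>i\<in>V. x i) = (\<Sum>i\<in>V. real (deg i) * x i)" by (simp add: algebra_simps)
  then show ?thesis
    by (simp add: dfc_def left_diff_distrib sum_subtractf sum_distrib_left)
qed

lemma sum_dfc_le:
  assumes "W \<subseteq> V" "0 \<le> gap"
  shows "(\<Sum>i\<in>W. dfc i * x i) \<le> gap * card V"
proof -
  have "(\<Sum>i\<in>W. dfc i * x i) \<le> (\<Sum>i\<in>V. dfc i * x i)"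
    using assms finite_V dfc_nonneg x_nonneg by (intro sum_mono2) auto
  also have "\<dots> = gap * (\<Sum>i\<in>V. x i)" by (rule sum_dfc_eq)
  also have "\<dots> \<le> gap * (\<Sum>i\<in>V. 1)"
    using assms x_le_1 by (intro mult_left_mono sum_mono) auto
  finally show ?thesis by simp
qed

text \<open>In \<open>gap_norm_eq\<close>, the deficient end of the path contributes at least the
  square of its entry, and the path bounds the energy. A positive \<open>K\<close> in place of the
  exact number of edges also covers the one-vertex path.\<close>

lemma gap_norm_ge:
  assumes "path p" "real (length p - 1) \<le> K" "0 < K" "last p \<in> V" "deg (last p) \<noteq> \<Delta>"
  shows "(1 - \<alpha>) * (x (hd p))\<^sup>2 \<le> (K + (1 - \<alpha>)) * (gap * (\<Sum>i\<in>V. (x i)\<^sup>2))"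
proof -
  let ?v = "last p"
  have "(x (hd p) - x ?v)\<^sup>2 \<le> real (length p - 1) * energy x"
    using assms(1) by (rule path_difference_le_energy)
  also have "\<dots> \<le> K * energy x"
    using assms energy_nonneg by (intro mult_right_mono) auto
  finally have "(1 - \<alpha>) * (x (hd p))\<^sup>2 \<le> (K + (1 - \<alpha>)) * ((x ?v)\<^sup>2 + (1 - \<alpha>) * energy x)"
    using alpha assms by (intro weighted_squares_ge) auto
  also have "\<dots> \<le> (K + (1 - \<alpha>)) * (gap * (\<Sum>i\<in>V. (x i)\<^sup>2))"
  proof (intro mult_left_mono)
    have "(x ?v)\<^sup>2 \<le> dfc ?v * (x ?v)\<^sup>2"
      using dfc_ge_1 assms mult_right_mono[of 1 "dfc ?v" "(x ?v)\<^sup>2"] by simp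
    also have "\<dots> \<le> (\<Sum>i\<in>V. dfc i * (x i)\<^sup>2)"
      using assms finite_V dfc_nonneg by (intro member_le_sum) auto
    finally show "(x ?v)\<^sup>2 + (1 - \<alpha>) * energy x \<le> gap * (\<Sum>i\<in>V. (x i)\<^sup>2)"
      unfolding gap_norm_eq by simp
  qed (use alpha assms in auto)
  finally show ?thesis .
qed

text \<open>At most \<open>D - 1\<close> edges give the constant \<open>D - \<alpha>\<close>, no
  larger than the required \<open>D - \<alpha> / 2\<close>. Strictness comes from an entry below 1
  at \<open>last p\<close>, which makes the squared norm less than the number of vertices.\<close>

lemma gap_gt_if_near:
  assumes p: "path p" "length p \<le> D" "2 \<le> D"
    and u: "hd p \<in> V" "x (hd p) = 1" and v: "last p \<in> V" "deg (last p) \<noteq> \<Delta>"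
  shows "(1 - \<alpha>) / ((real D - \<alpha> / 2) * card V) < gap"
proof -
  let ?N = "\<Sum>i\<in>V. (x i)\<^sup>2" and ?v = "last p"
  define n where "n = real (card V)"
  have n: "n > 0" using u(1) finite_V by (auto simp: n_def card_gt_0_iff)
  have g: "0 \<le> gap" using u gap_nonneg[of "hd p"] by simp
  have R: "1 - \<alpha> < real D - \<alpha> / 2" "real D - \<alpha> \<le> real D - \<alpha> / 2" using p alpha by auto
  have "1 - \<alpha> < gap * n * (real D - \<alpha> / 2)"
  proof (cases "x ?v = 1")
    \<comment> \<open>Here \<open>sum_dfc_le\<close> at the single vertex \<open>last p\<close>
      already gives \<open>gap * n \<ge> 1\<close>.\<close>
    case True
    have "1 \<le> dfc ?v" using v by (rule dfc_ge_1)
    also have "\<dots> \<le> gap * n" using sum_dfc_le[of "{?v}"] v g True by (simp add: n_def)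
    finally have "1 * (1 - \<alpha>) < gap * n * (real D - \<alpha> / 2)"
      using R alpha by (intro mult_le_less_imp_less) auto
    then show ?thesis by simp
  next
    case False
    then have t: "x ?v < 1" using x_le_1[OF v(1)] by simp
    have "?N < (\<Sum>i\<in>V. 1)"
    proof (rule sum_strict_mono_ex1)
      show "\<forall>i\<in>V. (x i)\<^sup>2 \<le> 1" using x_nonneg x_le_1 by (auto simp: power_le_one)
      show "\<exists>i\<in>V. (x i)\<^sup>2 < 1" using t v x_nonneg by (intro bexI[of _ ?v]) (auto simp: power_less_one_iff)
    qed (rule finite_V)
    then have N: "?N < n" by (simp add: n_def)
    have "real (length p - 1) \<le> real D - 1" using p by (auto simp: path_def)
    then have "(1 - \<alpha>) * (x (hd p))\<^sup>2 \<le> ((real D - 1) + (1 - \<alpha>)) * (gap * ?N)"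
      using p v by (intro gap_norm_ge) auto
    then have *: "1 - \<alpha> \<le> (real D - \<alpha>) * (gap * ?N)" using u by simp
    have "gap \<noteq> 0" using * alpha by auto
    then have "gap > 0" using g by simp
    have "(real D - \<alpha>) * (gap * ?N) < (real D - \<alpha>) * (gap * n)"
      using N \<open>gap > 0\<close> p alpha by (intro mult_strict_left_mono) auto
    also have "\<dots> \<le> (real D - \<alpha> / 2) * (gap * n)"
      using R g n by (intro mult_right_mono) auto
    finally show ?thesis using * by (simp add: mult.commute)
  qed
  then show ?thesis using R alpha n unfolding n_def by (simp add: field_simps)
qed

text \<open>At a maximal entry all drops \<open>1 - x j\<close> to neighbours are nonnegative, and
  the eigenvalue equation fixes their sum, so it bounds each of them.\<close>

lemma nb_gap:
  assumes "u \<in> V" "x u = 1" "E u w"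
  shows "(1 - \<alpha>) * (1 - x w) \<le> gap"
proof -
  have w: "w \<in> nb u" using assms by (simp add: nb_def)
  have "1 - x w \<le> (\<Sum>j\<in>nb u. 1 - x j)"
    using w x_le_1 nb_subset by (intro member_le_sum[of w]) auto
  also have "\<dots> = deg u - (\<Sum>j\<in>nb u. x j)" by (simp add: deg_def sum_subtractf)
  finally have "(1 - \<alpha>) * (1 - x w) \<le> (1 - \<alpha>) * (deg u - (\<Sum>j\<in>nb u. x j))"
    using alpha by (intro mult_left_mono) auto
  also have "\<dots> = deg u - \<mu>" using eigen[OF assms(1)] assms(2) by (simp add: algebra_simps)
  also have "\<dots> \<le> gap" using deg_le[OF assms(1)] by simp
  finally show ?thesis .
qed

text \<open>The neighbour with the smallest entry lies below the average over all neighbours, which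
  the eigenvalue equation at \<open>v\<close> determines.\<close>

lemma small_nb:
  assumes "v \<in> V" "deg v \<noteq> 0" "0 \<le> gap"
  obtains y where "E v y" "(1 - \<alpha>) * deg v * (x y - x v) \<le> dfc v * x v"
proof -
  let ?m = "Min (x ` nb v)"
  have ne: "nb v \<noteq> {}" using assms by (auto simp: deg_def)
  then have "?m \<in> x ` nb v" by (intro Min_in) auto
  then obtain y where y: "y \<in> nb v" "x y = ?m" by auto
  have "deg v * x y = (\<Sum>j\<in>nb v. x y)" by (simp add: deg_def)
  also have "\<dots> \<le> (\<Sum>j\<in>nb v. x j)" unfolding y(2) by (intro sum_mono Min_le) auto
  finally have "(1 - \<alpha>) * (deg v * x y) \<le> (1 - \<alpha>) * (\<Sum>j\<in>nb v. x j)"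
    using alpha by (intro mult_left_mono) auto
  also have "\<dots> = (\<mu> - \<alpha> * deg v) * x v" using eigen[OF assms(1)] by (simp add: algebra_simps)
  finally have "(1 - \<alpha>) * deg v * (x y - x v) \<le> (dfc v - gap) * x v"
    by (simp add: algebra_simps dfc_def)
  also have "\<dots> \<le> dfc v * x v"
    using assms x_nonneg by (intro mult_right_mono) auto
  finally show ?thesis using that y by (simp add: nb_def)
qed

text \<open>
  If the eigenvalue gap were too small, the neighbour \<open>w\<close> of \<open>u\<close> would have an entry close
  to the maximum and one edge less to go to \<open>v\<close>. The loss in passing from \<open>u\<close> to \<open>w\<close> is of
  order \<open>1 / n\<close>; it is outweighed by the entries of \<open>v\<close> and of one neighbour of \<open>v\<close>, which are
  bounded away from 1, so that \<open>\<Sum>i\<in>V. (x i)\<^sup>2\<close> falls short of \<open>n\<close> by a constant.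
\<close>

lemma gap_gt_if_far:
  assumes p: "path (u # w # q)" "length q < D" "2 \<le> D"
    and u: "u \<in> V" "x u = 1"
    and v: "v = last (w # q)" "v \<in> V" "deg v \<noteq> \<Delta>" "deg v \<noteq> 0"
    and alt: "2 \<le> deg v \<or> 2 \<le> dfc v \<or> (\<exists>v'\<in>V. v' \<noteq> v \<and> deg v' \<noteq> \<Delta> \<and> x v \<le> x v')"
  shows "(1 - \<alpha>) / ((real D - \<alpha> / 2) * card V) < gap"
proof (rule ccontr)
  let ?N = "\<Sum>i\<in>V. (x i)\<^sup>2"
  define n where "n = real (card V)"
  define R where "R = real D - \<alpha> / 2"
  define \<beta> where "\<beta> = 1 - \<alpha>"
  \<comment> \<open>In this scaling \<open>nb_gap\<close> reads
    \<open>x w \<ge> 1 - \<delta>\<close>, and the negated claim reads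
    \<open>\<delta> * n * R \<le> 1\<close>.\<close>
  define \<delta> where "\<delta> = gap / \<beta>"
  assume "\<not> ?thesis"
  then have neg: "gap \<le> \<beta> / (R * n)" by (simp add: R_def n_def \<beta>_def)
  have n: "n \<ge> 1" using u(1) finite_V by (auto simp: n_def Suc_le_eq card_gt_0_iff)
  have \<beta>: "\<beta> > 0" "\<beta> \<le> 1" using alpha by (auto simp: \<beta>_def)
  have R: "R > 1" "2 - \<alpha> / 2 \<le> R" using p alpha by (auto simp: R_def)
  have g: "0 \<le> gap" using u gap_nonneg[of u] by simp
  have gap: "gap = \<beta> * \<delta>" and \<delta>0: "0 \<le> \<delta>" using \<beta> g by (auto simp: \<delta>_def)
  have \<delta>R: "\<delta> * n * R \<le> 1" using neg \<beta> R n unfolding gap by (simp add: field_simps)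
  have "\<delta> * 1 * 1 \<le> \<delta> * n * R" using n R \<delta>0 by (intro mult_mono) auto
  then have \<delta>1: "\<delta> \<le> 1" using \<delta>R by simp

  have "E u w" using p by (simp add: path_def)
  then have "\<beta> * (1 - x w) \<le> \<beta> * \<delta>" using nb_gap[OF u] gap by (simp add: \<beta>_def)
  then have w: "1 - \<delta> \<le> x w" using \<beta> by simp
  have "path (w # q)" using p by (simp add: path_def)
  then have "\<beta> * (x w)\<^sup>2 \<le> (real D - 1 + \<beta>) * (gap * ?N)"
    using gap_norm_ge[of "w # q" "real D - 1"] p v by (simp add: \<beta>_def)
  then have "\<beta> * (x w)\<^sup>2 \<le> \<beta> * ((real D - \<alpha>) * (\<delta> * ?N))"
    unfolding gap by (simp add: \<beta>_def mult_ac)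
  then have "(x w)\<^sup>2 \<le> (real D - \<alpha>) * (\<delta> * ?N)" using \<beta> by simp
  moreover have "(1 - \<delta>)\<^sup>2 \<le> (x w)\<^sup>2" using w \<delta>1 by (intro power_mono) auto
  moreover have "(real D - \<alpha>) * (\<delta> * ?N) \<le> R * (\<delta> * ?N)"
    using alpha \<delta>0 by (intro mult_right_mono mult_nonneg_nonneg sum_nonneg) (auto simp: R_def)
  moreover have "1 - 2 * \<delta> \<le> (1 - \<delta>)\<^sup>2" by (simp add: power2_diff)
  ultimately have "1 - 2 * \<delta> \<le> R * \<delta> * ?N" by simp
  \<comment> \<open>Multiplying by \<open>n\<close> lets \<open>\<delta> * n * R \<le> 1\<close>
    remove the factor in front of \<open>?N\<close>, leaving a lower bound on the squared
    norm.\<close>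
  then have "n * (1 - 2 * \<delta>) \<le> n * (R * \<delta> * ?N)" using n by (intro mult_left_mono) auto
  also have "\<dots> = (\<delta> * n * R) * ?N" by simp
  also have "\<dots> \<le> 1 * ?N" using \<delta>R by (intro mult_right_mono sum_nonneg) auto
  finally have lower: "n - 2 * (n * \<delta>) \<le> ?N" by (simp add: algebra_simps)

  obtain y where y: "E v y" "\<beta> * deg v * (x y - x v) \<le> dfc v * x v"
    using small_nb[OF v(2,4) g] unfolding \<beta>_def by blast
  have yV: "y \<in> V" "y \<noteq> v" using y E_in E_irrefl by auto
  have xv: "0 \<le> x v" "x v \<le> 1" and xy: "0 \<le> x y" "x y \<le> 1"
    using x_nonneg x_le_1 v yV by auto
  define T where "T = n * \<delta>"
  have T: "0 \<le> T" "T * R \<le> 1" using \<delta>0 \<delta>R n by (auto simp: T_def mult_ac)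
  have dv: "1 \<le> dfc v" using v by (intro dfc_ge_1)
  have dT: "dfc v * x v \<le> \<beta> * T"
    using sum_dfc_le[of "{v}"] v g unfolding gap by (simp add: T_def n_def mult_ac)
  have "x v \<le> dfc v * x v" using dv xv mult_right_mono[of 1 "dfc v" "x v"] by simp
  then have tT: "x v \<le> \<beta> * T" using dT by simp
  \<comment> \<open>Without \<open>alt\<close>, adding \<open>x v \<le> \<beta> * T\<close> and
    \<open>x y - x v \<le> T\<close> gives only the factor \<open>2 - \<alpha>\<close>. Each
    alternative halves at least one of the two bounds; the worst case, \<open>dfc v \<ge> 2\<close>,
    yields \<open>\<beta> / 2 + 1 = 3 / 2 - \<alpha> / 2\<close>.\<close>
  have yT: "x y \<le> (3 / 2 - \<alpha> / 2) * T"
  proof -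
    have y': "x y - x v \<le> dfc v * x v / (\<beta> * deg v)"
      using y(2) \<beta> v(4) by (simp add: field_simps)
    consider "2 \<le> deg v" | "2 \<le> dfc v"
      | v' where "v' \<in> V" "v' \<noteq> v" "deg v' \<noteq> \<Delta>" "x v \<le> x v'" "dfc v < 2"
      using alt by force
    then show ?thesis
    proof cases
      case 1
      have "dfc v * x v / (\<beta> * deg v) \<le> \<beta> * T / (\<beta> * 2)"
        using 1 dT \<beta> T dv xv by (intro frac_le mult_left_mono) auto
      also have "\<dots> = T / 2" using \<beta> by simp
      finally have "x y - x v \<le> T / 2" using y' by linarith
      moreover have "0 \<le> \<alpha> * T" using alpha T by simp
      ultimately show ?thesis using tT by (simp add: \<beta>_def algebra_simps)
    next
      case 2
      have "dfc v * x v / (\<beta> * deg v) \<le> \<beta> * T / (\<beta> * 1)"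
        using v(4) dT \<beta> T dv xv by (intro frac_le mult_left_mono) auto
      also have "\<dots> = T" using \<beta> by simp
      finally have "x y - x v \<le> T" using y' by linarith
      moreover have "2 * x v \<le> dfc v * x v" using 2 xv by (intro mult_right_mono) auto
      ultimately show ?thesis using dT by (simp add: \<beta>_def algebra_simps)
    next
      case 3
      \<comment> \<open>Two deficient vertices share the bound \<open>\<beta> * T\<close>, and the
        smaller entry \<open>x v\<close> takes at most half of it.\<close>
      have "dfc v * x v + dfc v' * x v' \<le> \<beta> * T"
        using sum_dfc_le[of "{v, v'}"] v 3 g unfolding gap by (simp add: T_def n_def mult_ac)
      moreover have "x v' \<le> dfc v' * x v'"
        using dfc_ge_1[of v'] 3 x_nonneg[of v'] mult_right_mono[of 1 "dfc v'" "x v'"] by simp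
      moreover have "dfc v = 1"
      proof -
        have "real \<Delta> < real (deg v + 2)" "real (deg v + 1) \<le> real \<Delta>"
          using \<open>dfc v < 2\<close> dv by (auto simp: dfc_def)
        then have "\<Delta> = deg v + 1" unfolding of_nat_less_iff of_nat_le_iff by simp
        then show ?thesis unfolding dfc_def by simp
      qed
      ultimately have h: "2 * x v \<le> \<beta> * T" using 3 by simp
      have "dfc v * x v / (\<beta> * deg v) \<le> (\<beta> * T / 2) / (\<beta> * 1)"
        using v(4) h \<beta> T dv xv \<open>dfc v = 1\<close> by (intro frac_le mult_left_mono) auto
      also have "\<dots> = T / 2" using \<beta> by simp
      finally have "x y - x v \<le> T / 2" using y' by linarith
      moreover have "0 \<le> T" by (rule T)
      ultimately show ?thesis using h by (simp add: \<beta>_def algebra_simps)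
    qed
  qed
  have "?N = (\<Sum>i\<in>V - {v, y}. (x i)\<^sup>2) + ((x v)\<^sup>2 + (x y)\<^sup>2)"
    using sum.subset_diff[of "{v, y}" V "\<lambda>i. (x i)\<^sup>2"] v yV finite_V by simp
  also have "(\<Sum>i\<in>V - {v, y}. (x i)\<^sup>2) \<le> (\<Sum>i\<in>V - {v, y}. 1)"
    using x_nonneg x_le_1 by (intro sum_mono) (auto simp: power_le_one)
  also have "\<dots> = n - 2"
    using v yV finite_V card_mono[of V "{v, y}"] by (simp add: n_def card_Diff_subset)
  finally have "2 \<le> 2 * T + (x v)\<^sup>2 + (x y)\<^sup>2" using lower by (simp add: T_def)
  also have "\<dots> \<le> 2 * T + (\<beta> * T)\<^sup>2 + ((3 / 2 - \<alpha> / 2) * T)\<^sup>2"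
    using tT yT xv xy by (intro add_mono power_mono) auto
  \<comment> \<open>The factor \<open>R\<^sup>2\<close> pairs every \<open>T\<close> with an
    \<open>R\<close>, so that \<open>T * R \<le> 1\<close> eliminates \<open>T\<close> and
    \<open>quadratic_gap\<close> applies.\<close>
  finally have "R\<^sup>2 * 2 \<le> R\<^sup>2 * (2 * T + (\<beta> * T)\<^sup>2 + ((3 / 2 - \<alpha> / 2) * T)\<^sup>2)"
    by (intro mult_left_mono) auto
  also have "\<dots> = 2 * R * (T * R) + (\<beta>\<^sup>2 + (3 / 2 - \<alpha> / 2)\<^sup>2) * (T * R)\<^sup>2"
    by (simp add: power2_eq_square algebra_simps)
  also have "\<dots> \<le> 2 * R * 1 + (\<beta>\<^sup>2 + (3 / 2 - \<alpha> / 2)\<^sup>2) * 1"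
    using T R by (intro add_mono mult_left_mono power_le_one) auto
  finally show False
    using quadratic_gap[OF alpha R(2)] by (simp add: \<beta>_def)
qed

lemma gap_gt:
  assumes D: "2 \<le> D" and top: "\<exists>u\<in>V. x u = 1" and irreg: "\<exists>v\<in>V. deg v \<noteq> \<Delta>"
    and deg_pos: "\<And>v. v \<in> V \<Longrightarrow> deg v \<noteq> 0"
    and diam: "\<And>u v. u \<in> V \<Longrightarrow> v \<in> V \<Longrightarrow> \<exists>p. path p \<and> hd p = u \<and> last p = v \<and> length p \<le> Suc D"
  shows "(1 - \<alpha>) / ((real D - \<alpha> / 2) * card V) < gap"
proof -
  obtain u where u: "u \<in> V" "x u = 1" using top by blast
  define W where "W = {v \<in> V. deg v \<noteq> \<Delta>}"
  have "finite W" "W \<noteq> {}" using irreg finite_V by (auto simp: W_def)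
  \<comment> \<open>Minimality of the entry at \<open>v\<close> supplies
    \<open>x v \<le> x v'\<close> for any second deficient vertex in \<open>alt\<close>.\<close>
  then obtain v where vW: "v \<in> W" and min: "\<And>v'. v' \<in> W \<Longrightarrow> x v \<le> x v'"
    using arg_min_least[of W _ x] arg_min_if_finite(1)[of W x] by metis
  then have v: "v \<in> V" "deg v \<noteq> \<Delta>" by (auto simp: W_def)
  txt \<open>Otherwise \<open>\<Delta> = 2\<close> and \<open>v\<close> is the only vertex of odd degree.\<close>
  have alt: "2 \<le> deg v \<or> 2 \<le> dfc v \<or> (\<exists>v'\<in>V. v' \<noteq> v \<and> deg v' \<noteq> \<Delta> \<and> x v \<le> x v')"
  proof (rule ccontr)
    assume neg: "\<not> ?thesis"
    then have "deg v = 1" "\<Delta> = 2"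
      using deg_pos[OF v(1)] dfc_ge_1[OF v] by (auto simp: dfc_def)
    moreover have "deg v' = \<Delta>" if "v' \<in> V - {v}" for v'
      using neg min[of v'] that by (auto simp: W_def)
    ultimately have "(\<Sum>i\<in>V. deg i) = 1 + (\<Sum>i\<in>V - {v}. 2)"
      using v finite_V by (simp add: sum.remove[of V v])
    then show False using even_sum_deg by simp
  qed
  obtain p where p: "path p" "hd p = u" "last p = v" "length p \<le> Suc D"
    using diam u v by blast
  \<comment> \<open>\<open>length p \<le> D\<close> means at most \<open>D - 1\<close> edges.
    Otherwise there are exactly \<open>D\<close> edges, and dropping \<open>u\<close> leaves
    \<open>D - 1\<close>.\<close>
  show ?thesis
  proof (cases "length p \<le> D")
    case True
    then show ?thesis using gap_gt_if_near[of p D] p D u v by simp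
  next
    case False
    then have len: "length p = Suc D" using p by simp
    then obtain w q where pq: "p = u # w # q"
      using p D by (cases p; cases "tl p") auto
    then show ?thesis
      using gap_gt_if_far[of u w q D v] p(1,3) len D u v deg_pos alt by simp
  qed
qed

end

section \<open>Application to digraphs\<close>

lemma (in wf_digraph) awalk_successively:
  assumes "awalk u p v"
  shows "successively (\<lambda>a b. a \<rightarrow>\<^bsub>G\<^esub> b) (awalk_verts u p)"
  using assms
proof (induction p arbitrary: u)
  case (Cons e p)
  then have e: "tail G e \<rightarrow>\<^bsub>G\<^esub> head G e" and w: "awalk (head G e) p v"
    by (auto simp: awalk_Cons_iff intro: in_arcs_imp_in_arcs_ends)
  have "hd (awalk_verts (head G e) p) = head G e" using w by blast
  then show ?case using Cons.IH[OF w] e by (simp add: successively_Cons)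
qed simp

lemma (in fin_digraph) out_degree_eq_card_successors:
  assumes "nomulti_digraph G"
  shows "out_degree G u = card {v. u \<rightarrow>\<^bsub>G\<^esub> v}"
proof -
  have "{v. u \<rightarrow>\<^bsub>G\<^esub> v} = head G ` out_arcs G u"
    by (auto simp: arcs_ends_def arc_to_ends_def out_arcs_def)
  moreover have "inj_on (head G) (out_arcs G u)"
    using nomulti_digraph.no_multi_arcs[OF assms]
    by (auto simp: inj_on_def out_arcs_def arc_to_ends_def)
  ultimately show ?thesis by (simp add: out_degree_def card_image)
qed

text \<open>Connectedness makes the set under \<open>LEAST\<close> in \<open>vert_dist\<close>
  nonempty, so the distance is realised by a path; finiteness makes the \<open>Max\<close> an upper
  bound.\<close>

lemma short_apath_exists:
  assumes "graph G" "Digraph_Component.connected G" "u \<in> verts G" "v \<in> verts G"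
  obtains p where "pre_digraph.apath G u p v" "length p \<le> graph_diameter G"
proof -
  interpret graph G by fact
  have "strongly_connected G"
    using assms sym_arcs by (intro symmetric_connected_imp_strongly_connected)
  then have "u \<rightarrow>\<^sup>*\<^bsub>G\<^esub> v" using assms by blast
  then have "\<exists>k p. apath u p v \<and> length p = k" by (simp add: reachable_apath)
  then have "\<exists>p. apath u p v \<and> length p = vert_dist G u v"
    unfolding vert_dist_def by (rule LeastI_ex)
  moreover have "vert_dist G u v \<le> graph_diameter G"
    unfolding graph_diameter_def
  proof (rule Max_ge)
    have "{vert_dist G u v |u v. u \<in> verts G \<and> v \<in> verts G} =
        (\<lambda>(u, v). vert_dist G u v) ` (verts G \<times> verts G)" by auto
    then show "finite {vert_dist G u v |u v. u \<in> verts G \<and> v \<in> verts G}" by simp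
  qed (use assms in blast)
  ultimately show ?thesis using that by metis
qed

theorem theorem3p2:
  fixes G :: "('a, 'b) pre_digraph" and vs :: "'a list"
    and n \<Delta> D :: nat and \<alpha> :: real
  assumes "graph G"
    and "Digraph_Component.connected G"
    and "irregular G"
    and "distinct vs" and "set vs = verts G"
    and "n = card (verts G)"
    and "\<Delta> = max_degree G"
    and "D = graph_diameter G"
    and "0 \<le> \<alpha>" and "\<alpha> < 1"
  shows "rho_alpha \<alpha> G vs < real \<Delta> - 2 * (1 - \<alpha>) / ((2 * real D - \<alpha>) * real n)"
proof -
  interpret graph G by fact
  let ?V = "verts G" and ?E = "\<lambda>u v. u \<rightarrow>\<^bsub>G\<^esub> v"
  interpret S: simple_graph ?V ?E
  proof
    show "u \<rightarrow>\<^bsub>G\<^esub> v \<Longrightarrow> v \<rightarrow>\<^bsub>G\<^esub> u" for u v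
      using sym_arcs by (auto simp: symmetric_def dest: symD)
    show "\<not> u \<rightarrow>\<^bsub>G\<^esub> u" for u
      using no_loops by (auto simp: arcs_ends_def arc_to_ends_def)
  qed (auto simp: adj_in_verts)
  have deg: "out_degree G u = S.deg u" for u
    unfolding S.deg_def S.nb_def by (rule out_degree_eq_card_successors) unfold_locales
  obtain v0 v1 where v01: "v0 \<in> ?V" "v1 \<in> ?V" "S.deg v0 \<noteq> S.deg v1"
    using \<open>irregular G\<close> by (auto simp: irregular_def deg)
  have path: "\<exists>p. S.path p \<and> hd p = u \<and> last p = v \<and> length p \<le> Suc D"
    if uv: "u \<in> ?V" "v \<in> ?V" for u v
  proof -
    obtain p where "apath u p v" "length p \<le> D"
      using short_apath_exists[OF assms(1,2) uv] assms(8) by metis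
    then show ?thesis
      using awalk_successively[of u p v]
      by (intro exI[of _ "awalk_verts u p"]) (auto simp: S.path_def apath_def length_awalk_verts)
  qed
  \<comment> \<open>Irregularity provides a second vertex, and a path to it leaves \<open>u\<close>
    through a neighbour.\<close>
  have deg_pos: "S.deg u \<noteq> 0" if u: "u \<in> ?V" for u
  proof -
    obtain v where v: "v \<in> ?V" "v \<noteq> u" using v01 by metis
    obtain p where p: "S.path p" "hd p = u" "last p = v" using path[OF u v(1)] by blast
    then obtain w q where "p = u # w # q" using v(2)
      by (cases p; cases "tl p") (auto simp: S.path_def)
    then have "w \<in> S.nb u" using p by (simp add: S.path_def S.nb_def)
    then show ?thesis by (auto simp: S.deg_def)
  qed
  \<comment> \<open>With diameter at most 1 any two distinct vertices would be adjacent, so the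
    graph would be complete and hence regular.\<close>
  have D: "2 \<le> D"
  proof (rule ccontr)
    assume "\<not> 2 \<le> D"
    then have len: "Suc D \<le> 2" by simp
    have "S.nb u = ?V - {u}" if u: "u \<in> ?V" for u
    proof -
      have "u \<rightarrow>\<^bsub>G\<^esub> v" if v: "v \<in> ?V" "v \<noteq> u" for v
      proof -
        obtain p where p: "S.path p" "hd p = u" "last p = v" "length p \<le> 2"
          using path[OF u v(1)] len le_trans by blast
        then obtain w q where "p = u # w # q" using v(2)
          by (cases p; cases "tl p") (auto simp: S.path_def)
        then show ?thesis using p by (simp add: S.path_def)
      qed
      then show ?thesis using S.nb_subset[of u] S.E_irrefl by (auto simp: S.nb_def)
    qed
    then show False using v01 by (simp add: S.deg_def)
  qed
  have deg_le: "S.deg u \<le> \<Delta>" if "u \<in> ?V" for u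
    using that assms(7) by (simp add: max_degree_def deg)
  have irreg: "\<exists>v\<in>?V. S.deg v \<noteq> \<Delta>" using v01 by metis
  \<comment> \<open>The entries of the matrix indexed by vertices instead of positions in
    \<open>vs\<close>.\<close>
  define a where "a u v = (if u = v then \<alpha> * S.deg u else 0) + (1 - \<alpha>) * (if u \<rightarrow>\<^bsub>G\<^esub> v then 1 else 0)" for u v
  have sum_a: "(\<Sum>j\<in>?V. a i j * x j) = \<alpha> * real (S.deg i) * x i + (1 - \<alpha>) * (\<Sum>j\<in>S.nb i. x j)"
    if i: "i \<in> ?V" for i x
  proof -
    have "(\<Sum>j\<in>?V. a i j * x j) =
        (\<Sum>j\<in>?V. (if i = j then \<alpha> * S.deg i * x j else 0) + (1 - \<alpha>) * (if j \<in> S.nb i then x j else 0))"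
      by (intro sum.cong) (auto simp: a_def S.nb_def algebra_simps)
    also have "\<dots> = \<alpha> * S.deg i * x i + (1 - \<alpha>) * (\<Sum>j\<in>?V. if j \<in> S.nb i then x j else 0)"
      using i by (simp add: sum.distrib flip: sum_distrib_left)
    also have "(\<Sum>j\<in>?V. if j \<in> S.nb i then x j else 0) = (\<Sum>j\<in>S.nb i. x j)"
      using S.nb_subset[of i] by (simp add: Int_absorb1 flip: sum.inter_restrict)
    finally show ?thesis .
  qed
  have A: "A_alpha \<alpha> G vs = Matrix.mat (length vs) (length vs) (\<lambda>(i, j). a (vs ! i) (vs ! j))"
    using assms(4) by (intro eq_matI)
      (auto simp: A_alpha_def deg_mat_def adj_mat_def mat_diag_def a_def deg nth_eq_iff_index_eq)
  have a_sym: "a i j = a j i" for i j using S.E_sym by (auto simp: a_def)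
  have a_nonneg: "0 \<le> a i j" for i j using assms(9,10) by (simp add: a_def)
  have V_ne: "?V \<noteq> {}" using v01 by auto
  obtain x \<mu> where \<mu>: "Max (spectrum (A_alpha \<alpha> G vs)) \<le> \<mu>"
    and x: "\<forall>i\<in>?V. 0 \<le> x i \<and> x i \<le> 1" "\<exists>i\<in>?V. x i = 1"
    and eig: "\<forall>i\<in>?V. (\<Sum>j\<in>?V. a i j * x j) = \<mu> * x i"
    by (rule nonneg_eigenpair_of_max_eigenvalue[where a = a, OF assms(4,5) V_ne a_sym a_nonneg A]) (rule that)
  interpret P: alpha_eigenpair ?V ?E x \<alpha> \<mu> \<Delta>
  proof
    show "\<alpha> * real (S.deg i) * x i + (1 - \<alpha>) * (\<Sum>j\<in>S.nb i. x j) = \<mu> * x i" if "i \<in> ?V" for i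
      using sum_a[OF that, of x] eig that by simp
  qed (use assms(9,10) x deg_le in auto)
  have "(1 - \<alpha>) / ((real D - \<alpha> / 2) * n) < real \<Delta> - \<mu>"
    using P.gap_gt[OF D x(2) irreg deg_pos path] assms(6) by simp
  moreover have "(1 - \<alpha>) / ((real D - \<alpha> / 2) * n) = 2 * (1 - \<alpha>) / ((2 * real D - \<alpha>) * n)"
    by (simp add: field_simps)
  ultimately show ?thesis using \<mu> by (simp add: rho_alpha_def)
qed

end
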